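(* Let $(X,\mu,\mathcal{E},\mathcal{F})$ be a symmetric Dirichlet space whose semigroup $\{P_t\}$ is conservative and admits a measurable heat kernel $p_t(x,y)$ satisfying, for some $C>0$ and $\beta>0$, \[ p_t(x,y)\le C\,t^{-\beta} \] for $\mu\times\mu$-a.e. $(x,y)\in X\times X$ and each $t\in(0,+\infty)$. Let $0<\alpha<\beta$ and $1\le p<\frac{\beta}{\alpha}$. Then there exists a constant $C_{p,\alpha}>0$ such that for every $f\in\mathbf{B}^{p,\alpha}(X)$, \[ \sup_{s\ge0}\ s\,\mu\left(\{x\in X:|f(x)|\ge s\}\right)^{1/q}\le C_{p,\alpha}\,\|f\|_{p,\alpha},\qquad q=\frac{p\beta}{\beta-p\alpha}. \]
   Context: $X$ is a topological space equipped with a Radon measure $\mu$; $\mathcal{E}$ is a symmetric Dirichlet form on $L^2(X,\mu)$ with domain $\mathcal{F}$; $\{P_t\}_{t\ge0}$ is the associated Markovian semigroup; conservative means $P_t1=1$. A heat kernel is a (symmetric, nonnegative, measurable) function $p_t(x,y)$ with $P_tf(x)=\int_Xp_t(x,y)f(y)\,d\mu(y)$. For $p\ge1$, $\alpha\ge0$, $f\in L^p(X,\mu)$, \[ \|f\|_{p,\alpha}=\sup_{t>0}t^{-\alpha}\left(\int_X\int_X|f(x)-f(y)|^pp_t(x,y)\,d\mu(x)\,d\mu(y)\right)^{1/p}, \] and $\mathbf{B}^{p,\alpha}(X)=\{f\in L^p(X,\mu):\|f\|_{p,\alpha}<\infty\}$. (At $s=0$ the product $s\,\mu(\cdot)^{1/q}$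 is read as $0$.) *)

theory Defs
  imports "HOL-Analysis.Analysis"
begin

text \<open>
  Functions are real-valued and are not quotiented by almost-everywhere equality; every notion
  below that concerns elements of \<open>L\<^sup>p\<close> is stated modulo equality a.e. instead.
\<close>

text \<open>
  Compact sets are Borel in Hausdorff spaces; as no separation axiom is imposed, the
  measurability of \<open>K\<close> is required explicitly.
\<close>
definition radon_measure :: "'a::topological_space measure \<Rightarrow> bool" where
  "radon_measure M \<longleftrightarrow>
     sets M = sets borel \<and>
     (\<forall>x. \<exists>U. open U \<and> x \<in> U \<and> emeasure M U < \<infinity>) \<and>
     (\<forall>A\<in>sets M. emeasure M A = (SUP K\<in>{K. compact K \<and> K \<in> sets M \<and> K \<subseteq> A}. emeasure M K))"

definition Lp_set :: "'a measure \<Rightarrow> real \<Rightarrow> ('a \<Rightarrow> real) set" where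
  "Lp_set M p = {f. f \<in> borel_measurable M \<and> integrable M (\<lambda>x. \<bar>f x\<bar> powr p)}"

definition L2_inner :: "'a measure \<Rightarrow> ('a \<Rightarrow> real) \<Rightarrow> ('a \<Rightarrow> real) \<Rightarrow> real" where
  "L2_inner M f g = (\<integral>x. f x * g x \<partial>M)"

definition L2_norm_fun :: "'a measure \<Rightarrow> ('a \<Rightarrow> real) \<Rightarrow> real" where
  "L2_norm_fun M f = sqrt (L2_inner M f f)"


subsection \<open>Symmetric Dirichlet forms\<close>

definition L2_dense_subspace :: "'a measure \<Rightarrow> ('a \<Rightarrow> real) set \<Rightarrow> bool" where
  "L2_dense_subspace M F \<longleftrightarrow>
     F \<subseteq> Lp_set M 2 \<and>
     (\<lambda>x. 0) \<in> F \<and>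
     (\<forall>f\<in>F. \<forall>g\<in>F. (\<lambda>x. f x + g x) \<in> F) \<and>
     (\<forall>c. \<forall>f\<in>F. (\<lambda>x. c * f x) \<in> F) \<and>
     (\<forall>f\<in>F. \<forall>g\<in>borel_measurable M. (AE x in M. f x = g x) \<longrightarrow> g \<in> F) \<and>
     (\<forall>f\<in>Lp_set M 2. \<forall>e>0. \<exists>g\<in>F. L2_norm_fun M (\<lambda>x. f x - g x) < e)"

definition symmetric_form ::
  "'a measure \<Rightarrow> (('a \<Rightarrow> real) \<Rightarrow> ('a \<Rightarrow> real) \<Rightarrow> real) \<Rightarrow> ('a \<Rightarrow> real) set \<Rightarrow> bool" where
  "symmetric_form M E F \<longleftrightarrow>
     (\<forall>f\<in>F. \<forall>g\<in>F. \<forall>h\<in>F. (AE x in M. f x = g x) \<longrightarrow> E f h = E g h) \<and>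
     (\<forall>f\<in>F. \<forall>g\<in>F. E f g = E g f) \<and>
     (\<forall>f\<in>F. \<forall>g\<in>F. \<forall>h\<in>F. E (\<lambda>x. f x + g x) h = E f h + E g h) \<and>
     (\<forall>c. \<forall>f\<in>F. \<forall>h\<in>F. E (\<lambda>x. c * f x) h = c * E f h) \<and>
     (\<forall>f\<in>F. 0 \<le> E f f)"

definition form_norm ::
  "'a measure \<Rightarrow> (('a \<Rightarrow> real) \<Rightarrow> ('a \<Rightarrow> real) \<Rightarrow> real) \<Rightarrow> ('a \<Rightarrow> real) \<Rightarrow> real" where
  "form_norm M E f = sqrt (E f f + L2_inner M f f)"

definition closed_form ::
  "'a measure \<Rightarrow> (('a \<Rightarrow> real) \<Rightarrow> ('a \<Rightarrow> real) \<Rightarrow> real) \<Rightarrow> ('a \<Rightarrow> real) set \<Rightarrow> bool" where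
  "closed_form M E F \<longleftrightarrow>
     (\<forall>u::nat \<Rightarrow> 'a \<Rightarrow> real.
        (\<forall>n. u n \<in> F) \<and>
        (\<forall>e>0. \<exists>N. \<forall>m\<ge>N. \<forall>n\<ge>N. form_norm M E (\<lambda>x. u m x - u n x) < e) \<longrightarrow>
        (\<exists>v\<in>F. (\<lambda>n. form_norm M E (\<lambda>x. u n x - v x)) \<longlonglongrightarrow> 0))"

definition markovian_form ::
  "(('a \<Rightarrow> real) \<Rightarrow> ('a \<Rightarrow> real) \<Rightarrow> real) \<Rightarrow> ('a \<Rightarrow> real) set \<Rightarrow> bool" where
  "markovian_form E F \<longleftrightarrow>
     (\<forall>f\<in>F. (\<lambda>x. min (max (f x) 0) 1) \<in> F \<and>
       E (\<lambda>x. min (max (f x) 0) 1) (\<lambda>x. min (max (f x) 0) 1) \<le> E f f)"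

definition symmetric_dirichlet_form ::
  "'a measure \<Rightarrow> (('a \<Rightarrow> real) \<Rightarrow> ('a \<Rightarrow> real) \<Rightarrow> real) \<Rightarrow> ('a \<Rightarrow> real) set \<Rightarrow> bool" where
  "symmetric_dirichlet_form M E F \<longleftrightarrow>
     L2_dense_subspace M F \<and> symmetric_form M E F \<and> closed_form M E F \<and> markovian_form E F"


subsection \<open>The associated Markovian semigroup\<close>

definition markovian_semigroup ::
  "'a measure \<Rightarrow> (real \<Rightarrow> ('a \<Rightarrow> real) \<Rightarrow> 'a \<Rightarrow> real) \<Rightarrow> bool" where
  "markovian_semigroup M P \<longleftrightarrow>
     (\<forall>t\<ge>0. \<forall>f\<in>Lp_set M 2. P t f \<in> Lp_set M 2) \<and>
     (\<forall>t\<ge>0. \<forall>f\<in>Lp_set M 2. \<forall>g\<in>Lp_set M 2.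
        (AE x in M. f x = g x) \<longrightarrow> (AE x in M. P t f x = P t g x)) \<and>
     (\<forall>t\<ge>0. \<forall>f\<in>Lp_set M 2. \<forall>g\<in>Lp_set M 2.
        AE x in M. P t (\<lambda>y. f y + g y) x = P t f x + P t g x) \<and>
     (\<forall>t\<ge>0. \<forall>c. \<forall>f\<in>Lp_set M 2. AE x in M. P t (\<lambda>y. c * f y) x = c * P t f x) \<and>
     (\<forall>f\<in>Lp_set M 2. AE x in M. P 0 f x = f x) \<and>
     (\<forall>s\<ge>0. \<forall>t\<ge>0. \<forall>f\<in>Lp_set M 2. AE x in M. P (s + t) f x = P s (P t f) x) \<and>
     (\<forall>t\<ge>0. \<forall>f\<in>Lp_set M 2. \<forall>g\<in>Lp_set M 2. L2_inner M (P t f) g = L2_inner M f (P t g)) \<and>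
     (\<forall>t\<ge>0. \<forall>f\<in>Lp_set M 2. L2_norm_fun M (P t f) \<le> L2_norm_fun M f) \<and>
     (\<forall>f\<in>Lp_set M 2. ((\<lambda>t. L2_norm_fun M (\<lambda>x. P t f x - f x)) \<longlongrightarrow> 0) (at_right 0)) \<and>
     (\<forall>t\<ge>0. \<forall>f\<in>Lp_set M 2. (AE x in M. 0 \<le> f x \<and> f x \<le> 1) \<longrightarrow>
        (AE x in M. 0 \<le> P t f x \<and> P t f x \<le> 1))"

text \<open>
  The graph of the infinitesimal generator: \<open>f\<close> lies in its domain and is mapped to \<open>h\<close>.
\<close>
definition generator_graph ::
  "'a measure \<Rightarrow> (real \<Rightarrow> ('a \<Rightarrow> real) \<Rightarrow> 'a \<Rightarrow> real) \<Rightarrow> ('a \<Rightarrow> real) \<Rightarrow> ('a \<Rightarrow> real) \<Rightarrow> bool" where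
  "generator_graph M P f h \<longleftrightarrow>
     f \<in> Lp_set M 2 \<and> h \<in> Lp_set M 2 \<and>
     ((\<lambda>t. L2_norm_fun M (\<lambda>x. (P t f x - f x) / t - h x)) \<longlongrightarrow> 0) (at_right 0)"

text \<open>
  \<open>P\<close> is the semigroup of the form when its generator is the self-adjoint operator \<open>L\<close> of the
  form, i.e. the operator determined by \<open>E(f,v) = -\<langle>L f, v\<rangle>\<close> for all \<open>v\<close> in the form domain.
\<close>
definition associated_semigroup ::
  "'a measure \<Rightarrow> (('a \<Rightarrow> real) \<Rightarrow> ('a \<Rightarrow> real) \<Rightarrow> real) \<Rightarrow> ('a \<Rightarrow> real) set \<Rightarrow>
   (real \<Rightarrow> ('a \<Rightarrow> real) \<Rightarrow> 'a \<Rightarrow> real) \<Rightarrow> bool" where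
  "associated_semigroup M E F P \<longleftrightarrow>
     markovian_semigroup M P \<and>
     (\<forall>f h. generator_graph M P f h \<longleftrightarrow>
        f \<in> F \<and> h \<in> Lp_set M 2 \<and> (\<forall>v\<in>F. E f v = - L2_inner M h v))"

text \<open>
  \<open>semigroup_ext M P t f g\<close>: the extension of \<open>P\<^sub>t\<close> from \<open>L\<^sup>2\<close> to nonnegative bounded functions
  maps \<open>f\<close> to \<open>g\<close>.  As usual, \<open>P\<^sub>t f\<close> is the a.e. limit of \<open>P\<^sub>t u\<^sub>n\<close> for \<open>0 \<le> u\<^sub>n \<up> f\<close> with
  \<open>u\<^sub>n\<close> in \<open>L\<^sup>2\<close>; positivity and symmetry of \<open>P\<^sub>t\<close> make it independent of the approximating
  sequence.
\<close>
definition semigroup_ext ::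
  "'a measure \<Rightarrow> (real \<Rightarrow> ('a \<Rightarrow> real) \<Rightarrow> 'a \<Rightarrow> real) \<Rightarrow> real \<Rightarrow> ('a \<Rightarrow> real) \<Rightarrow> ('a \<Rightarrow> real) \<Rightarrow> bool"
  where
  "semigroup_ext M P t f g \<longleftrightarrow>
     (\<exists>u::nat \<Rightarrow> 'a \<Rightarrow> real.
        (\<forall>n. u n \<in> Lp_set M 2) \<and>
        (AE x in M. 0 \<le> u 0 x \<and> incseq (\<lambda>n. u n x) \<and> (\<lambda>n. u n x) \<longlonglongrightarrow> f x) \<and>
        (AE x in M. (\<lambda>n. P t (u n) x) \<longlonglongrightarrow> g x))"

text \<open>
  \<open>P\<^sub>t 1 = 1\<close>.  For \<open>P\<^sub>t 1\<close> to be defined the constant \<open>1\<close> has to be an increasing limit of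
  \<open>L\<^sup>2\<close> functions, so a conservative semigroup forces the measure to be sigma-finite, and
  the product measure appearing below is well behaved without a separate assumption.
\<close>
definition conservative_semigroup ::
  "'a measure \<Rightarrow> (real \<Rightarrow> ('a \<Rightarrow> real) \<Rightarrow> 'a \<Rightarrow> real) \<Rightarrow> bool" where
  "conservative_semigroup M P \<longleftrightarrow> (\<forall>t\<ge>0. semigroup_ext M P t (\<lambda>x. 1) (\<lambda>x. 1))"

text \<open>
  The Bochner integral of a non-integrable function is \<open>0\<close>, hence the explicit integrability
  in the last clause.
\<close>
definition heat_kernel ::
  "'a measure \<Rightarrow> (real \<Rightarrow> ('a \<Rightarrow> real) \<Rightarrow> 'a \<Rightarrow> real) \<Rightarrow> (real \<Rightarrow> 'a \<Rightarrow> 'a \<Rightarrow> real) \<Rightarrow> bool" where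
  "heat_kernel M P k \<longleftrightarrow>
     (\<forall>t>0. (\<lambda>(x, y). k t x y) \<in> borel_measurable (M \<Otimes>\<^sub>M M)) \<and>
     (\<forall>t>0. \<forall>x\<in>space M. \<forall>y\<in>space M. 0 \<le> k t x y) \<and>
     (\<forall>t>0. \<forall>x\<in>space M. \<forall>y\<in>space M. k t x y = k t y x) \<and>
     (\<forall>t>0. \<forall>f\<in>Lp_set M 2.
        AE x in M. integrable M (\<lambda>y. k t x y * f y) \<and> P t f x = (\<integral>y. k t x y * f y \<partial>M))"


subsection \<open>Heat semigroup Besov spaces\<close>

definition ennreal_powr :: "ennreal \<Rightarrow> real \<Rightarrow> ennreal" where
  "ennreal_powr a r = (if a = \<infinity> then \<infinity> else ennreal (enn2real a powr r))"

definition besov_seminorm ::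
  "'a measure \<Rightarrow> (real \<Rightarrow> 'a \<Rightarrow> 'a \<Rightarrow> real) \<Rightarrow> real \<Rightarrow> real \<Rightarrow> ('a \<Rightarrow> real) \<Rightarrow> ennreal" where
  "besov_seminorm M k p \<alpha> f =
     (SUP t\<in>{0<..}. ennreal (t powr (- \<alpha>)) *
        ennreal_powr (\<integral>\<^sup>+ y. (\<integral>\<^sup>+ x. ennreal (\<bar>f x - f y\<bar> powr p * k t x y) \<partial>M) \<partial>M) (1 / p))"

definition besov_space ::
  "'a measure \<Rightarrow> (real \<Rightarrow> 'a \<Rightarrow> 'a \<Rightarrow> real) \<Rightarrow> real \<Rightarrow> real \<Rightarrow> ('a \<Rightarrow> real) set" where
  "besov_space M k p \<alpha> = {f \<in> Lp_set M p. besov_seminorm M k p \<alpha> f < \<infinity>}"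

end

theory Submission
  imports Defs
begin

text \<open>
  Let \<open>A = {\<bar>f\<bar> \<ge> 2 s}\<close> and \<open>B = {\<bar>f\<bar> \<ge> s}\<close>, and choose \<open>t\<close> with \<open>C t powr (-\<beta>) \<mu>(B) = 1/2\<close>.  By the
  upper bound the heat kernel started at \<open>y \<in> A\<close> puts mass at most \<open>1/2\<close> on \<open>B\<close>, so by
  conservativeness it puts mass at least \<open>1/2\<close> on the complement, where \<open>\<bar>f(x) - f(y)\<bar> \<ge> s\<close>.  With
  \<open>\<theta> = p\<alpha>/\<beta>\<close> and \<open>N\<close> the Besov seminorm of \<open>f\<close> this gives
  \<open>s powr p \<mu>(A) / 2 \<le> t powr (p\<alpha>) N powr p = (2 C \<mu>(B)) powr \<theta> N powr p\<close>.
  Hence \<open>G(s) = s powr q \<mu>(\<bar>f\<bar> \<ge> s)\<close> satisfies \<open>G(2 s) \<le> K G(s) powr \<theta>\<close>.  As \<open>f \<in> L\<^sup>p\<close> and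
  \<open>q \<ge> p\<close>, the supremum \<open>S\<close> of \<open>G\<close> over \<open>(0, r]\<close> is finite, and \<open>S \<le> K S powr \<theta>\<close> bounds it
  independently of \<open>r\<close>.
\<close>

text \<open>The real-variable half of the argument, with \<open>m\<close> in the role of the
  distribution function. The exponent \<open>q\<close> is the one that closes the doubling
  inequality in terms of \<open>s powr q * m s\<close> alone. The bound \<open>L\<close> only
  ensures that a supremum is finite, so it does not enter the final constant.\<close>

lemma weak_type_iteration:
  fixes m :: "real \<Rightarrow> real"
  assumes "0 < p" "0 < \<theta>" "\<theta> < 1" "0 \<le> D" "q = p / (1 - \<theta>)"
    and nonneg: "\<And>s. 0 \<le> m s"
    and step: "\<And>s. 0 < s \<Longrightarrow> s powr p * m (2 * s) \<le> D * m s powr \<theta>"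
    and chebyshev: "\<And>s. 0 < s \<Longrightarrow> s powr p * m s \<le> L"
    and "0 < r"
  shows "r * m r powr (1 / q) \<le> (2 powr q * D) powr (1 / p)"
proof -
  define G where "G s = s powr q * m s" for s
  define K where "K = 2 powr q * D"
  define S where "S = Sup (G ` {0<..r})"
  have q: "p \<le> q" "0 < q" "q * (1 - \<theta>) = p"
    using assms(1-3) unfolding assms(5) by (auto simp: pos_le_divide_eq mult_left_le)
  have K: "0 \<le> K" using assms(4) by (simp add: K_def)
  have G_nonneg: "0 \<le> G s" for s using nonneg by (simp add: G_def)
  \<comment> \<open>The factor \<open>s powr (q - p)\<close> is controlled by
    \<open>r powr (q - p)\<close> only up to \<open>r\<close>, which is why the supremum is
    truncated there.\<close>
  have G_le: "G s \<le> r powr (q - p) * L" if "0 < s" "s \<le> r" for s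
  proof -
    have "G s = s powr (q - p) * (s powr p * m s)"
      by (simp add: G_def flip: powr_add mult.assoc)
    also have "\<dots> \<le> r powr (q - p) * L"
      using that chebyshev[of s] q(1) nonneg
      by (intro mult_mono powr_mono2) (auto intro!: mult_nonneg_nonneg)
    finally show ?thesis .
  qed
  have bdd: "bdd_above (G ` {0<..r})"
    using G_le by (intro bdd_aboveI2[where M = "r powr (q - p) * L"]) auto
  have G_S: "G s \<le> S" if "0 < s" "s \<le> r" for s
    unfolding S_def using that by (intro cSUP_upper bdd) auto
  have S_nonneg: "0 \<le> S" using G_S[of r] G_nonneg[of r] \<open>0 < r\<close> by simp
  have G_double: "G (2 * s) \<le> K * G s powr \<theta>" if "0 < s" for s
  proof -
    have "G (2 * s) = 2 powr q * s powr (q * \<theta>) * (s powr p * m (2 * s))"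
    proof -
      \<comment> \<open>This is \<open>q * (1 - \<theta>) = p\<close> again: the second factor is
        consumed by \<open>step\<close>, the first one recombines with
        \<open>m s powr \<theta>\<close> into \<open>G s powr \<theta>\<close>.\<close>
      have "s powr q = s powr (q * \<theta>) * s powr p"
        using q(3) by (simp add: algebra_simps flip: powr_add)
      then show ?thesis using that by (simp add: G_def powr_mult)
    qed
    also have "\<dots> \<le> 2 powr q * s powr (q * \<theta>) * (D * m s powr \<theta>)"
      using step[OF that] by (intro mult_left_mono) auto
    also have "\<dots> = K * G s powr \<theta>"
      using that nonneg by (simp add: G_def K_def powr_mult powr_powr)
    finally show ?thesis .
  qed
  have "S \<le> K * S powr \<theta>"
    unfolding S_def
  proof (rule cSUP_least)
    show "{0<..r} \<noteq> {}" using \<open>0 < r\<close> by auto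
    fix s assume s: "s \<in> {0<..r}"
    \<comment> \<open>Halving stays inside the interval, so the same supremum reappears on the
      right.\<close>
    have "G s \<le> K * G (s / 2) powr \<theta>" using G_double[of "s / 2"] s by simp
    also have "\<dots> \<le> K * S powr \<theta>"
      using s G_nonneg G_S[of "s / 2"] K assms(2) by (intro mult_left_mono powr_mono2) auto
    finally show "G s \<le> K * Sup (G ` {0<..r}) powr \<theta>" by (simp add: S_def)
  qed
  \<comment> \<open>Since \<open>S\<close> is a finite real, \<open>S powr \<theta>\<close> can be
    divided out; for \<open>S = 0\<close> the left side is 0.\<close>
  then have S_le: "S powr (1 - \<theta>) \<le> K"
    using S_nonneg K by (cases "S = 0") (auto simp: powr_diff divide_simps)
  have "r * m r powr (1 / q) = G r powr (1 / q)"
    using \<open>0 < r\<close> q nonneg by (simp add: G_def powr_mult powr_powr)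
  also have "\<dots> \<le> S powr (1 / q)"
    using G_S[of r] G_nonneg \<open>0 < r\<close> q by (intro powr_mono2) auto
  also have "\<dots> = (S powr (1 - \<theta>)) powr (1 / p)"
    using assms(1,3,5) by (simp add: powr_powr)
  also have "\<dots> \<le> K powr (1 / p)"
    using S_le assms(1) by (intro powr_mono2) auto
  finally show ?thesis by (simp add: K_def)
qed

lemma Lp_set_level:
  assumes "f \<in> Lp_set M p" "0 < p" "0 < s"
  shows "emeasure M {x \<in> space M. \<bar>f x\<bar> \<ge> s} < \<infinity>"
    and "s powr p * measure M {x \<in> space M. \<bar>f x\<bar> \<ge> s} \<le> (\<integral>x. \<bar>f x\<bar> powr p \<partial>M)"
proof -
  have int: "integrable M (\<lambda>x. \<bar>f x\<bar> powr p)" and f[measurable]: "f \<in> borel_measurable M"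
    using assms(1) by (auto simp: Lp_set_def)
  have eq: "{x \<in> space M. \<bar>f x\<bar> \<ge> s} = {x \<in> space M. \<bar>f x\<bar> powr p \<ge> s powr p}"
  proof -
    have "s \<le> \<bar>a\<bar> \<longleftrightarrow> s powr p \<le> \<bar>a\<bar> powr p" for a :: real
      using assms(2,3) powr_mono2[of p s "\<bar>a\<bar>"] powr_less_mono2[of p "\<bar>a\<bar>" s] by force
    then show ?thesis by simp
  qed
  have "emeasure M {x \<in> space M. \<bar>f x\<bar> \<ge> s} \<le> ennreal (1 / s powr p * (\<integral>x. \<bar>f x\<bar> powr p \<partial>M))"
    unfolding eq by (rule integral_Markov_inequality[OF int]) (use assms in auto)
  then show "emeasure M {x \<in> space M. \<bar>f x\<bar> \<ge> s} < \<infinity>"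
    using le_less_trans by fastforce
  show "s powr p * measure M {x \<in> space M. \<bar>f x\<bar> \<ge> s} \<le> (\<integral>x. \<bar>f x\<bar> powr p \<partial>M)"
    using integral_Markov_inequality_measure[OF int, of "{}" "s powr p"] assms(3)
    unfolding eq by (auto simp: field_simps)
qed

text \<open>Square-integrable functions converging to 1 a.e. exceed 1/2 on sets of finite measure
  that cover almost everything.\<close>

lemma conservative_sigma_finite:
  assumes "conservative_semigroup M P"
  shows "sigma_finite_measure M"
proof -
  obtain u :: "nat \<Rightarrow> 'a \<Rightarrow> real" where u: "\<And>n. u n \<in> Lp_set M 2"
    and lim: "AE x in M. (\<lambda>n. u n x) \<longlonglongrightarrow> 1"
    using assms[unfolded conservative_semigroup_def, rule_format, of 0]
    unfolding semigroup_ext_def by auto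
  have [measurable]: "u n \<in> borel_measurable M" for n
    using u by (auto simp: Lp_set_def)
  define A where "A n = {x \<in> space M. \<bar>u n x\<bar> \<ge> 1 / 2}" for n
  have A: "A n \<in> sets M" "emeasure M (A n) < \<infinity>" for n
    unfolding A_def using Lp_set_level(1)[OF u, of "1 / 2"] by auto
  \<comment> \<open>The points missed by every \<open>A n\<close> form a null set; adjoining it
    makes the cover exact.\<close>
  define N where "N = space M - (\<Union>n. A n)"
  have N: "N \<in> sets M" using A(1) by (auto simp: N_def)
  have "AE x in M. x \<notin> N"
    using lim
  proof eventually_elim
    case (elim x)
    have "\<forall>\<^sub>F n in sequentially. u n x > 1 / 2"
      by (rule order_tendstoD[OF elim]) simp
    then obtain n where "u n x > 1 / 2" by (auto simp: eventually_sequentially)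
    then show ?case by (auto simp: N_def A_def intro!: exI[of _ n])
  qed
  then have "emeasure M N = 0"
    using N AE_iff_measurable[of N M "\<lambda>x. x \<notin> N"] sets.sets_into_space by blast
  then show ?thesis
    using A N sets.sets_into_space[OF A(1)]
    by (intro sigma_finite_measure.intro exI[of _ "insert N (range A)"])
       (auto simp: N_def less_top)
qed

text \<open>The kernel formula is available only on \<open>Lp_set M 2\<close>, where the constant 1
  need not lie; it is carried over by monotone convergence along the approximating sequence.\<close>

lemma conservative_heat_kernel_mass:
  assumes "conservative_semigroup M P" "heat_kernel M P k" "0 < t"
  shows "AE x in M. integrable M (k t x) \<and> (\<integral>y. k t x y \<partial>M) = 1"
proof -
  interpret sigma_finite_measure M by (rule conservative_sigma_finite) fact
  obtain u :: "nat \<Rightarrow> 'a \<Rightarrow> real" where u: "\<And>n. u n \<in> Lp_set M 2"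
    and u_inc: "AE x in M. 0 \<le> u 0 x \<and> incseq (\<lambda>n. u n x) \<and> (\<lambda>n. u n x) \<longlonglongrightarrow> 1"
    and P_lim: "AE x in M. (\<lambda>n. P t (u n) x) \<longlonglongrightarrow> 1"
    using assms(1)[unfolded conservative_semigroup_def, rule_format, of t] assms(3)
    unfolding semigroup_ext_def by auto
  have k_meas[measurable]: "(\<lambda>(x, y). k t x y) \<in> borel_measurable (M \<Otimes>\<^sub>M M)"
    and k_nonneg: "\<And>x y. x \<in> space M \<Longrightarrow> y \<in> space M \<Longrightarrow> 0 \<le> k t x y"
    using assms(2,3) by (auto simp: heat_kernel_def)
  have P_eq: "AE x in M. \<forall>n. integrable M (\<lambda>y. k t x y * u n y) \<and>
      P t (u n) x = (\<integral>y. k t x y * u n y \<partial>M)"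
    using assms(2,3) u by (auto simp: heat_kernel_def AE_all_countable)
  show ?thesis
    using P_lim P_eq AE_space
  proof eventually_elim
    case (elim x)
    have int: "integrable M (\<lambda>y. k t x y * u n y)" for n using elim by blast
    have mono: "AE y in M. mono (\<lambda>n. k t x y * u n y)"
      using u_inc AE_space
      by eventually_elim (use elim(3) k_nonneg in \<open>auto simp: mono_def intro!: mult_left_mono\<close>)
    have lim: "AE y in M. (\<lambda>n. k t x y * u n y) \<longlonglongrightarrow> k t x y"
      using u_inc
    proof eventually_elim
      case (elim y)
      then show ?case using tendsto_mult_left[of "\<lambda>n. u n y" 1 sequentially "k t x y"] by simp
    qed
    \<comment> \<open>These integrals are \<open>P t (u n) x\<close>, so the limit 1 is
      conservativeness. It yields both the integrability and the value.\<close>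
    have ilim: "(\<lambda>n. \<integral>y. k t x y * u n y \<partial>M) \<longlonglongrightarrow> 1"
      using elim(1,2) by simp
    have meas: "k t x \<in> borel_measurable M"
      using elim(3) measurable_compose_Pair1[OF _ k_meas] by simp
    show ?case
      using integrable_monotone_convergence[OF int mono lim ilim meas]
        integral_monotone_convergence[OF int mono lim ilim meas] by simp
  qed
qed

text \<open>Keeps a single \<open>t\<close> of the defining supremum and solves for the
  energy.\<close>

lemma besov_energy_le:
  assumes "besov_seminorm M k p \<alpha> f < \<infinity>" "0 < p" "0 < t"
  shows "(\<integral>\<^sup>+ y. (\<integral>\<^sup>+ x. ennreal (\<bar>f x - f y\<bar> powr p * k t x y) \<partial>M) \<partial>M)
    \<le> ennreal (t powr (p * \<alpha>) * enn2real (besov_seminorm M k p \<alpha> f) powr p)"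
    (is "?I \<le> ennreal (_ * ?n powr p)")
proof -
  have n: "ennreal ?n = besov_seminorm M k p \<alpha> f"
    using assms(1) by (auto simp: less_top)
  have le: "ennreal (t powr (- \<alpha>)) * ennreal_powr ?I (1 / p) \<le> ennreal ?n"
    unfolding n unfolding besov_seminorm_def by (rule SUP_upper) (use assms in auto)
  \<comment> \<open>An infinite energy times the positive factor \<open>t powr (- \<alpha>)\<close>
    would make the seminorm infinite.\<close>
  have "?I \<noteq> \<infinity>"
  proof
    assume "?I = \<infinity>"
    then show False
      using le assms(3) by (simp add: ennreal_powr_def ennreal_mult_top top_unique)
  qed
  then obtain r where r: "?I = ennreal r" "0 \<le> r" by (cases ?I) auto
  have "ennreal (t powr (- \<alpha>) * r powr (1 / p)) \<le> ennreal ?n"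
    using le r by (simp add: ennreal_powr_def ennreal_mult)
  then have "t powr (- \<alpha>) * r powr (1 / p) \<le> ?n"
    by (subst (asm) ennreal_le_iff) auto
  then have "r powr (1 / p) \<le> t powr \<alpha> * ?n"
    using assms(3) by (simp add: powr_minus field_simps)
  then have "(r powr (1 / p)) powr p \<le> (t powr \<alpha> * ?n) powr p"
    using assms(2) by (intro powr_mono2) auto
  then have "r \<le> t powr (p * \<alpha>) * ?n powr p"
    using r(2) assms(2) by (simp add: powr_powr powr_mult mult.commute)
  then show ?thesis using r by (simp add: ennreal_leI)
qed

lemma level_set_energy:
  assumes "conservative_semigroup M P" "heat_kernel M P k" "0 < t"
    and f[measurable]: "f \<in> borel_measurable M"
    and "0 < s" "0 \<le> p" "0 \<le> b"
    and bound: "AE (x, y) in M \<Otimes>\<^sub>M M. k t x y \<le> b"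
    and fin: "emeasure M {x \<in> space M. \<bar>f x\<bar> \<ge> s} < \<infinity>"
    and small: "b * measure M {x \<in> space M. \<bar>f x\<bar> \<ge> s} \<le> 1 / 2"
  shows "ennreal (s powr p / 2) * emeasure M {x \<in> space M. \<bar>f x\<bar> \<ge> 2 * s}
    \<le> (\<integral>\<^sup>+ y. (\<integral>\<^sup>+ x. ennreal (\<bar>f x - f y\<bar> powr p * k t x y) \<partial>M) \<partial>M)"
proof -
  interpret sigma_finite_measure M by (rule conservative_sigma_finite) fact
  interpret pair_sigma_finite M M ..
  define A where "A = {x \<in> space M. \<bar>f x\<bar> \<ge> 2 * s}"
  define B where "B = {x \<in> space M. \<bar>f x\<bar> \<ge> s}"
  have [measurable]: "A \<in> sets M" "B \<in> sets M" by (auto simp: A_def B_def)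
  have k_nonneg: "\<And>x y. x \<in> space M \<Longrightarrow> y \<in> space M \<Longrightarrow> 0 \<le> k t x y"
    and k_sym: "\<And>x y. x \<in> space M \<Longrightarrow> y \<in> space M \<Longrightarrow> k t x y = k t y x"
    using assms(2,3) by (auto simp: heat_kernel_def)
  \<comment> \<open>Fubini for null sets: the bound holds along almost every section, with
    \<open>y\<close> as the starting point of the kernel. Symmetry restores the order
    \<open>k t x y\<close> at the end.\<close>
  have "AE y in M. AE x in M. k t y x \<le> b"
    using AE_pair[OF bound] by simp
  with conservative_heat_kernel_mass[OF assms(1-3)] AE_space
  have "AE y in M. ennreal (s powr p / 2) * indicator A y
      \<le> (\<integral>\<^sup>+ x. ennreal (\<bar>f x - f y\<bar> powr p * k t x y) \<partial>M)"
  proof eventually_elim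
    case (elim y)
    have int[measurable]: "integrable M (k t y)" using elim by blast
    have int_B: "integrable M (\<lambda>x. indicator B x * k t y x)"
      using integrable_mult_indicator[OF \<open>B \<in> sets M\<close> int] by simp
    have int_b: "integrable M (\<lambda>x. indicator B x * b)"
      using fin unfolding B_def[symmetric] by (intro integrable_mult_left) auto
    have "(\<integral>x. indicator B x * k t y x \<partial>M) \<le> (\<integral>x. indicator B x * b \<partial>M)"
      by (rule integral_mono_AE[OF int_B int_b])
         (use elim(3) in eventually_elim, auto simp: indicator_def)
    also have "\<dots> \<le> 1 / 2"
      using small by (simp add: B_def mult.commute)
    \<comment> \<open>Total mass 1 minus at most 1/2 on \<open>B\<close>; the integrand is the
      kernel restricted to the complement of \<open>B\<close>.\<close>
    finally have "1 / 2 \<le> (\<integral>x. k t y x - indicator B x * k t y x \<partial>M)"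
      using elim(1) int_B by (subst Bochner_Integration.integral_diff) auto
    then have half: "s powr p / 2 \<le> (\<integral>x. s powr p * (k t y x - indicator B x * k t y x) \<partial>M)"
      using mult_left_mono[of "1 / 2" _ "s powr p"] by simp
    show ?case
    proof (cases "y \<in> A")
      case True
      have "ennreal (s powr p / 2)
          \<le> ennreal (\<integral>x. s powr p * (k t y x - indicator B x * k t y x) \<partial>M)"
        using half by (rule ennreal_leI)
      also have "\<dots> = (\<integral>\<^sup>+ x. ennreal (s powr p * (k t y x - indicator B x * k t y x)) \<partial>M)"
        using int int_B elim(2) k_nonneg
        by (intro nn_integral_eq_integral[symmetric] AE_I2) (auto simp: indicator_def)
      also have "\<dots> \<le> (\<integral>\<^sup>+ x. ennreal (\<bar>f x - f y\<bar> powr p * k t x y) \<partial>M)"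
      proof (intro nn_integral_mono ennreal_leI)
        fix x assume x: "x \<in> space M"
        show "s powr p * (k t y x - indicator B x * k t y x) \<le> \<bar>f x - f y\<bar> powr p * k t x y"
        proof (cases "x \<in> B")
          case True
          then show ?thesis using k_nonneg[OF x elim(2)] by simp
        next
          case False
          \<comment> \<open>Reverse triangle inequality, from
            \<open>\<bar>f y\<bar> \<ge> 2 * s\<close> and
            \<open>\<bar>f x\<bar> < s\<close>.\<close>
          then have "s \<le> \<bar>f x - f y\<bar>"
            using x \<open>y \<in> A\<close> by (auto simp: A_def B_def)
          then have "s powr p \<le> \<bar>f x - f y\<bar> powr p"
            using assms(5,6) by (intro powr_mono2) auto
          then show ?thesis
            using False k_nonneg[OF x elim(2)] k_sym[OF x elim(2)]
            by (auto intro: mult_right_mono)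
        qed
      qed
      finally show ?thesis using True by simp
    qed simp
  qed
  then have "(\<integral>\<^sup>+ y. ennreal (s powr p / 2) * indicator A y \<partial>M)
      \<le> (\<integral>\<^sup>+ y. (\<integral>\<^sup>+ x. ennreal (\<bar>f x - f y\<bar> powr p * k t x y) \<partial>M) \<partial>M)"
    by (rule nn_integral_mono_AE)
  then show ?thesis by (simp add: nn_integral_cmult_indicator A_def)
qed

theorem theorem0p5:
  fixes M :: "'a::topological_space measure"
    and E :: "('a \<Rightarrow> real) \<Rightarrow> ('a \<Rightarrow> real) \<Rightarrow> real"
    and F :: "('a \<Rightarrow> real) set"
    and P :: "real \<Rightarrow> ('a \<Rightarrow> real) \<Rightarrow> 'a \<Rightarrow> real"
    and k :: "real \<Rightarrow> 'a \<Rightarrow> 'a \<Rightarrow> real"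
    and C \<beta> \<alpha> p q :: real
  assumes "radon_measure M"
    and "symmetric_dirichlet_form M E F"
    and "associated_semigroup M E F P"
    and "conservative_semigroup M P"
    and "heat_kernel M P k"
    and "C > 0" and "\<beta> > 0"
    and "\<forall>t>0. AE (x, y) in M \<Otimes>\<^sub>M M. k t x y \<le> C * t powr (- \<beta>)"
    and "0 < \<alpha>" and "\<alpha> < \<beta>"
    and "1 \<le> p" and "p < \<beta> / \<alpha>"
    and "q = p * \<beta> / (\<beta> - p * \<alpha>)"
  shows "\<exists>K::real. K > 0 \<and> (\<forall>f \<in> besov_space M k p \<alpha>.
           (SUP s\<in>{0..}. ennreal s * ennreal_powr (emeasure M {x \<in> space M. \<bar>f x\<bar> \<ge> s}) (1 / q))
             \<le> ennreal K * besov_seminorm M k p \<alpha> f)"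
proof -
  define \<theta> where "\<theta> = p * \<alpha> / \<beta>"
  have p: "0 < p" using assms(11) by simp
  have p\<alpha>: "p * \<alpha> < \<beta>" using assms(9,12) by (simp add: field_simps)
  have \<theta>: "0 < \<theta>" "\<theta> < 1" using p p\<alpha> assms(7,9) by (auto simp: \<theta>_def field_simps)
  have q: "q = p / (1 - \<theta>)"
    using assms(7,13) p\<alpha> by (simp add: \<theta>_def divide_simps)
  \<comment> \<open>The factor 2 undoes the lost half of the mass;
    \<open>(2 * C) powr \<theta>\<close> comes from \<open>t powr (p * \<alpha>)\<close> at the
    chosen time.\<close>
  define D where "D = 2 * (2 * C) powr \<theta>"
  define K where "K = (2 powr q * D) powr (1 / p)"
  have K: "0 < K" using assms(6) by (simp add: K_def D_def)
  have "ennreal s * ennreal_powr (emeasure M {x \<in> space M. \<bar>f x\<bar> \<ge> s}) (1 / q)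
      \<le> ennreal K * besov_seminorm M k p \<alpha> f"
    if f: "f \<in> besov_space M k p \<alpha>" and "0 \<le> s" for f s
  proof -
    have f_Lp: "f \<in> Lp_set M p" and fin: "besov_seminorm M k p \<alpha> f < \<infinity>"
      and f_meas[measurable]: "f \<in> borel_measurable M"
      using f by (auto simp: besov_space_def Lp_set_def)
    define n where "n = enn2real (besov_seminorm M k p \<alpha> f)"
    define m where "m r = measure M {x \<in> space M. \<bar>f x\<bar> \<ge> r}" for r
    have m_nonneg: "0 \<le> m r" for r by (simp add: m_def)
    have em: "emeasure M {x \<in> space M. \<bar>f x\<bar> \<ge> r} = ennreal (m r)" if "0 < r" for r
      using Lp_set_level(1)[OF f_Lp p that]
      unfolding m_def by (intro emeasure_eq_ennreal_measure) auto
    have step: "r powr p * m (2 * r) \<le> (D * n powr p) * m r powr \<theta>" if r: "0 < r" for r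
    \<comment> \<open>If \<open>m r = 0\<close>, the formula for \<open>t\<close> would give the
      inadmissible time 0; monotonicity of the level sets then makes both sides vanish.\<close>
    proof (cases "m r = 0")
      case True
      have "emeasure M {x \<in> space M. \<bar>f x\<bar> \<ge> 2 * r} \<le> emeasure M {x \<in> space M. \<bar>f x\<bar> \<ge> r}"
        using r by (intro emeasure_mono) auto
      then have "m (2 * r) \<le> m r" using em[of r] em[of "2 * r"] r m_nonneg by simp
      then show ?thesis using True m_nonneg[of "2 * r"] by simp
    next
      case False
      then have mr: "0 < m r" using m_nonneg[of r] by simp
      \<comment> \<open>The time at which \<open>C * t powr (- \<beta>) * m r\<close> equals
        1/2.\<close>
      define t where "t = (2 * C * m r) powr (1 / \<beta>)"
      have t: "0 < t" using mr assms(6) by (simp add: t_def)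
      have t\<beta>: "t powr (- \<beta>) = inverse (2 * C * m r)"
        using mr assms(6,7) by (simp add: t_def powr_powr powr_minus)
      have t\<alpha>: "t powr (p * \<alpha>) = (2 * C) powr \<theta> * m r powr \<theta>"
        using mr assms(6) by (simp add: t_def powr_powr \<theta>_def powr_mult)
      have "ennreal (r powr p / 2) * emeasure M {x \<in> space M. \<bar>f x\<bar> \<ge> 2 * r}
          \<le> (\<integral>\<^sup>+ y. (\<integral>\<^sup>+ x. ennreal (\<bar>f x - f y\<bar> powr p * k t x y) \<partial>M) \<partial>M)"
      proof (rule level_set_energy[OF assms(4,5) t f_meas r])
        show "AE (x, y) in M \<Otimes>\<^sub>M M. k t x y \<le> C * t powr (- \<beta>)"
          using assms(8) t by blast
        show "C * t powr (- \<beta>) * measure M {x \<in> space M. \<bar>f x\<bar> \<ge> r} \<le> 1 / 2"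
          using mr assms(6) unfolding t\<beta> m_def[symmetric] by (simp add: field_simps)
      qed (use p assms(6) em[OF r] in auto)
      also have "\<dots> \<le> ennreal (t powr (p * \<alpha>) * n powr p)"
        unfolding n_def by (rule besov_energy_le[OF fin p t])
      finally have "ennreal (r powr p / 2 * m (2 * r)) \<le> ennreal (t powr (p * \<alpha>) * n powr p)"
        using em[of "2 * r"] r m_nonneg ennreal_mult[of "r powr p / 2" "m (2 * r)"] by simp
      then have "r powr p / 2 * m (2 * r) \<le> t powr (p * \<alpha>) * n powr p"
        by (subst (asm) ennreal_le_iff) auto
      then show ?thesis unfolding t\<alpha> by (simp add: D_def algebra_simps)
    qed
    show ?thesis
    \<comment> \<open>At \<open>s = 0\<close> the level set is the whole space, possibly of infinite
      measure; the product is still 0 in \<open>ennreal\<close>.\<close>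
    proof (cases "s = 0")
      case False
      with \<open>0 \<le> s\<close> have s: "0 < s" by simp
      have "s * m s powr (1 / q) \<le> (2 powr q * (D * n powr p)) powr (1 / p)"
        using weak_type_iteration[OF p \<theta> _ q m_nonneg step Lp_set_level(2)[OF f_Lp p, folded m_def] s]
        by (simp add: D_def)
      \<comment> \<open>The seminorm enters the iteration constant as \<open>n powr p\<close>, so
        the outer power \<open>1 / p\<close> returns it linearly and \<open>K\<close> does not
        depend on \<open>f\<close>.\<close>
      also have "\<dots> = K * n"
        using p by (simp add: K_def powr_mult powr_powr n_def D_def)
      finally have "ennreal (s * m s powr (1 / q)) \<le> ennreal (K * n)" by (rule ennreal_leI)
      then show ?thesis
        using s K fin m_nonneg em[OF s]
        by (simp add: ennreal_powr_def ennreal_mult n_def less_top)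
    qed simp
  qed
  then show ?thesis using K by (intro exI[of _ K]) (auto intro!: SUP_least)
qed

end
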